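(* Let $(X,d)$ be a compact metric space, let $\mathbb{I}=\{S_1,\dots,S_N\}$ be an iterated function system of similarities on $X$, and let $C\subseteq X$ be a non-empty compact set. Let $F_\emptyset$ be the homogeneous attractor of $\mathbb{I}$ and $F_C$ the inhomogeneous attractor of $\mathbb{I}$ with condensation $C$. Suppose that $\mathbb{I}$ satisfies the strong open set condition (SOSC). Then $$\overline{\dim}_{\mathrm B}F_C=\max\{\overline{\dim}_{\mathrm B}F_\emptyset,\ \overline{\dim}_{\mathrm B}C\}.$$
   Context: An iterated function system (IFS) of similarities on $X$ is a finite collection of maps $S_i:X\to X$ such that for each $i$ there is a constant $\mathrm{Lip}(S_i)\in(0,1)$ with $d(S_i(x),S_i(y))=\mathrm{Lip}(S_i)\,d(x,y)$ for all $x,y\in X$. The homogeneous attractor $F_\emptyset$ is the unique non-empty compact set with $F_\emptyset=\bigcup_{i=1}^N S_i(F_\emptyset)$. The inhomogeneous attractor $F_C$ is the unique non-empty compact set with $F_C=\bigcup_{i=1}^N S_i(F_C)\cup C$. The IFS satisfies the SOSC if there is a non-empty open set $U\subseteq X$ with $F_\emptyset\cap U\neq\emptyset$ and $\bigcup_{i=1}^N S_i(U)\subseteq U$ with the union disjoint. For a non-empty set $E\subseteq X$ and $\delta>0$, $N_\delta(E)$ is the minimum number of sets of diameter at most $\delta$ required to cover $E$, and $\overline{\dim}_{\mathrm B}E=\limsup_{\delta\to0}\frac{\log N_\delta(E)}{-\log\delta}$. *)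

theory Defs
  imports "HOL-Analysis.Analysis"
begin

text \<open>
  The compact metric space \<open>(X, d)\<close> is rendered as a type \<open>'a :: metric_space\<close> whose
  universe is compact. The maps \<open>S\<^sub>1, \<dots>, S\<^sub>N\<close> form a family \<open>S\<close> indexed by \<open>{1..N}\<close>; values of \<open>S\<close>
  at other indices are irrelevant.
\<close>

definition similarity_ifs :: "(nat \<Rightarrow> 'a \<Rightarrow> 'a::metric_space) \<Rightarrow> nat \<Rightarrow> bool" where
  "similarity_ifs S N \<longleftrightarrow>
     1 \<le> N \<and> (\<forall>i\<in>{1..N}. \<exists>r. 0 < r \<and> r < 1 \<and> (\<forall>x y. dist (S i x) (S i y) = r * dist x y))"

definition is_attractor ::
    "(nat \<Rightarrow> 'a \<Rightarrow> 'a::metric_space) \<Rightarrow> nat \<Rightarrow> 'a set \<Rightarrow> 'a set \<Rightarrow> bool" where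
  "is_attractor S N C F \<longleftrightarrow> F \<noteq> {} \<and> compact F \<and> F = (\<Union>i\<in>{1..N}. S i ` F) \<union> C"

text \<open>
  For \<open>C = {}\<close> this is the homogeneous attractor. Existence and uniqueness, which make the
  description below meaningful, are proved as \<open>is_attractor_ex1\<close>.
\<close>

definition attractor :: "(nat \<Rightarrow> 'a \<Rightarrow> 'a::metric_space) \<Rightarrow> nat \<Rightarrow> 'a set \<Rightarrow> 'a set" where
  "attractor S N C = (THE F. is_attractor S N C F)"

definition SOSC :: "(nat \<Rightarrow> 'a \<Rightarrow> 'a::metric_space) \<Rightarrow> nat \<Rightarrow> bool" where
  "SOSC S N \<longleftrightarrow>
     (\<exists>U. open U \<and> U \<noteq> {} \<and> attractor S N {} \<inter> U \<noteq> {} \<and>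
          (\<Union>i\<in>{1..N}. S i ` U) \<subseteq> U \<and> disjoint_family_on (\<lambda>i. S i ` U) {1..N})"

text \<open>
  The conjunct \<open>bounded A\<close> is needed because \<open>diameter\<close> is only meaningful on bounded sets.
  The minimum is over a nonempty set of numbers whenever \<open>E\<close> is totally bounded, in particular for
  every subset of a compact space.
\<close>

definition covering_number :: "real \<Rightarrow> 'a::metric_space set \<Rightarrow> nat" where
  "covering_number \<delta> E =
     (LEAST n. \<exists>\<A>. finite \<A> \<and> card \<A> = n \<and> E \<subseteq> \<Union>\<A> \<and> (\<forall>A\<in>\<A>. bounded A \<and> diameter A \<le> \<delta>))"

text \<open>The dimension is extended-real valued, since a compact set may have infinite box dimension.\<close>

definition upper_box_dim :: "'a::metric_space set \<Rightarrow> ereal" where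
  "upper_box_dim E = Limsup (at_right 0) (\<lambda>\<delta>. ereal (ln (real (covering_number \<delta> E)) / (- ln \<delta>)))"

lemma is_attractor_subset:
  assumes "similarity_ifs S N" and X: "compact (UNIV :: 'a::metric_space set)"
    and F: "is_attractor S N C F" and G: "is_attractor S N C (G :: 'a set)"
  shows "F \<subseteq> G"
proof -
  obtain r where r: "\<And>i. i \<in> {1..N} \<Longrightarrow> 0 < r i \<and> r i < 1 \<and>
      (\<forall>x y. dist (S i x) (S i y) = r i * dist x y)"
    using assms(1) unfolding similarity_ifs_def by metis
  define q where "q = Max (r ` {1..N})"
  have N: "{1..N} \<noteq> {}" using assms(1) by (auto simp: similarity_ifs_def)
  have rq: "r i \<le> q" if "i \<in> {1..N}" for i
    unfolding q_def using that by (intro Max_ge) auto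
  have "q \<in> r ` {1..N}" unfolding q_def using N by (intro Max_in) auto
  then have q: "0 < q" "q < 1" using r by auto
  have cG: "compact G" "closed G" and neG: "G \<noteq> {}"
    and GE: "G = (\<Union>i\<in>{1..N}. S i ` G) \<union> C"
    using G unfolding is_attractor_def by (blast intro: compact_imp_closed)+
  have FE: "F = (\<Union>i\<in>{1..N}. S i ` F) \<union> C" using F unfolding is_attractor_def by blast
  define D where "D = diameter (UNIV :: 'a set)"
  have D: "dist x y \<le> D" for x y :: 'a
    unfolding D_def by (rule diameter_bounded_bound) (auto intro: compact_imp_bounded X)
  have step: "\<forall>x\<in>F. infdist x G \<le> q ^ n * D" for n
  proof (induction n)
    case 0
    show ?case using neG D by (auto intro: infdist_le2)
  next
    case (Suc n)
    have Dp: "0 \<le> D" using D[of undefined undefined] by simp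
    show ?case
    proof
      fix x assume "x \<in> F"
      then consider "x \<in> C" | i y where "i \<in> {1..N}" "y \<in> F" "x = S i y"
        using FE by blast
      then show "infdist x G \<le> q ^ Suc n * D"
      proof cases
        case 1
        then have "x \<in> G" using GE by blast
        then show ?thesis using q Dp by simp
      next
        case 2
        obtain z where z: "z \<in> G" "infdist y G = dist y z"
        proof -
          obtain z where z: "z \<in> G" "\<forall>w\<in>G. dist y z \<le> dist y w"
            using continuous_attains_inf[OF cG(1) neG
                continuous_on_dist[OF continuous_on_const continuous_on_id]]
            by blast
          have "infdist y G = dist y z"
          proof (rule antisym)
            show "infdist y G \<le> dist y z" using z(1) by (rule infdist_le)
            show "dist y z \<le> infdist y G"
              unfolding infdist_notempty[OF neG] using z(2) by (intro cINF_greatest neG) blast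
          qed
          then show thesis using that z(1) by blast
        qed
        have "S i z \<in> G" using z GE 2 by blast
        moreover have "dist x (S i z) \<le> q * (q ^ n * D)"
        proof -
          have "dist x (S i z) = r i * dist y z" using r 2 by auto
          also have "\<dots> \<le> q * (q ^ n * D)"
            using Suc 2 z rq[OF 2(1)] q by (intro mult_mono) auto
          finally show ?thesis .
        qed
        ultimately show ?thesis by (auto intro: infdist_le2)
      qed
    qed
  qed
  show ?thesis
  proof
    fix x assume x: "x \<in> F"
    have "(\<lambda>n. q ^ n * D) \<longlonglongrightarrow> 0 * D"
      using q by (intro tendsto_mult LIMSEQ_realpow_zero tendsto_const) auto
    then have "infdist x G \<le> 0"
      using step x by (intro LIMSEQ_le_const[of _ 0]) auto
    then have "infdist x G = 0" using infdist_nonneg[of x G] by linarith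
    then show "x \<in> G" using in_closed_iff_infdist_zero[OF cG(2) neG] by blast
  qed
qed

lemma compact_type_nest:
  fixes K :: "nat \<Rightarrow> 'a::metric_space set"
  assumes "compact (UNIV :: 'a set)" "\<And>n. compact (K n)" "\<And>n. K n \<noteq> {}"
    and "\<And>m n. m \<le> n \<Longrightarrow> K n \<subseteq> K m"
  shows "\<Inter>(range K) \<noteq> {}"
  using assms
  by (intro compact_space_imp_nest[of euclidean])
     (auto simp: decseq_def compact_space_def compactin_euclidean_iff compact_imp_closed)

lemma is_attractor_exists:
  assumes "similarity_ifs S N" and X: "compact (UNIV :: 'a::metric_space set)"
    and C: "compact (C :: 'a set)"
  shows "\<exists>F. is_attractor S N C F"
proof -
  have N: "1 \<in> {1..N}" using assms(1) by (auto simp: similarity_ifs_def)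
  have cont: "continuous_on UNIV (S i)" if "i \<in> {1..N}" for i
  proof -
    obtain r where "0 < r" "\<forall>x y. dist (S i x) (S i y) = r * dist x y"
      using assms(1) \<open>i \<in> {1..N}\<close> unfolding similarity_ifs_def by blast
    then have "r-lipschitz_on UNIV (S i)" by (auto intro: lipschitz_onI)
    then show ?thesis by (rule lipschitz_on_continuous_on)
  qed
  define P where "P = (\<lambda>K. (\<Union>i\<in>{1..N}. S i ` K) \<union> C)"
  define K where "K = (\<lambda>n. (P ^^ n) UNIV)"
  have Pm: "P A \<subseteq> P B" if "A \<subseteq> B" for A B using that unfolding P_def by blast
  have K0: "K 0 = UNIV" and KS: "K (Suc n) = P (K n)" for n by (auto simp: K_def)
  have dec: "K (Suc n) \<subseteq> K n" for n by (induction n) (auto simp: K0 KS Pm)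
  have anti: "K n \<subseteq> K m" if "m \<le> n" for m n
    using that dec by (rule lift_Suc_antimono_le[rotated])
  have cK: "compact (K n) \<and> K n \<noteq> {}" for n
  proof (induction n)
    case 0
    then show ?case using X by (simp add: K0)
  next
    case (Suc n)
    have "compact (S i ` K n)" if "i \<in> {1..N}" for i
      using Suc cont[OF that] by (intro compact_continuous_image) (auto intro: continuous_on_subset)
    then have "compact (P (K n))" unfolding P_def by (intro compact_Un compact_UN C) auto
    moreover have "P (K n) \<noteq> {}" using Suc N unfolding P_def by blast
    ultimately show ?case by (simp add: KS)
  qed
  define F where "F = \<Inter>(range K)"
  have ne: "F \<noteq> {}" unfolding F_def using cK anti by (intro compact_type_nest X) auto
  have cF: "compact F"
  proof -
    have "closed F" unfolding F_def using cK by (intro closed_INT) (auto intro: compact_imp_closed)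
    then show ?thesis using compact_Int_closed[OF X, of F] by simp
  qed
  have "P F \<subseteq> F"
  proof -
    have "P F \<subseteq> K n" for n
    proof (cases n)
      case (Suc m)
      have "F \<subseteq> K m" unfolding F_def by blast
      then show ?thesis using Suc KS Pm by metis
    qed (simp add: K0)
    then show ?thesis unfolding F_def by blast
  qed
  moreover have "F \<subseteq> P F"
  proof
    fix x assume x: "x \<in> F"
    show "x \<in> P F"
    proof (cases "x \<in> C")
      case False
      define V where "V = (\<Union>i\<in>{1..N}. S i -` {x})"
      have "closed V" unfolding V_def using cont by (intro closed_UN) (auto intro: closed_vimage)
      then have "compact (K n \<inter> V)" for n using cK by (auto intro: compact_Int_closed)
      moreover have "K n \<inter> V \<noteq> {}" for n
      proof -
        have "x \<in> P (K n)" using x KS unfolding F_def by blast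
        then show ?thesis using False unfolding P_def V_def by auto
      qed
      ultimately have "\<Inter>(range (\<lambda>n. K n \<inter> V)) \<noteq> {}"
        using anti by (intro compact_type_nest X) blast+
      then obtain y where "y \<in> F" "y \<in> V" unfolding F_def by blast
      then show ?thesis unfolding P_def V_def by blast
    qed (simp add: P_def)
  qed
  ultimately have "F = P F" by blast
  then show ?thesis using ne cF unfolding is_attractor_def P_def by blast
qed

lemma is_attractor_ex1:
  assumes "similarity_ifs S N" "compact (UNIV :: 'a::metric_space set)" "compact (C :: 'a set)"
  shows "\<exists>!F. is_attractor S N C F"
proof (rule ex_ex1I)
  show "\<exists>F. is_attractor S N C F" by (rule is_attractor_exists[OF assms])
  show "F = G" if "is_attractor S N C F" "is_attractor S N C G" for F G
    using is_attractor_subset[OF assms(1,2) that] is_attractor_subset[OF assms(1,2) that(2,1)]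
    by (rule subset_antisym)
qed

end

theory Submission
  imports Defs
begin

text \<open>
  Write \<open>F\<close> for the homogeneous attractor, \<open>G\<close> for the inhomogeneous one, \<open>r\<^sub>i\<close> for the ratio of \<open>S\<^sub>i\<close>
  and \<open>N\<^sub>\<delta>\<close> for the covering number at scale \<open>\<delta>\<close>. A similarity with ratio \<open>\<rho>\<close> only rescales covers, so
  \<open>N\<^sub>\<delta>(T(E)) = N\<^bsub>\<delta>/\<rho>\<^esub>(E)\<close>. Self-similarity therefore turns into functional inequalities for covering
  numbers, and these can be solved by induction from coarse scales to fine ones, without unfolding
  \<open>G\<close> into an infinite union of copies of \<open>C\<close>.

  Upper bound (\<open>upper_box_dim_inhomogeneous_le\<close>): the identity \<open>G = \<Union>\<^sub>i S\<^sub>i(G) \<union> C\<close> gives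
  \<open>N\<^sub>\<delta>(G) \<le> \<Sum>\<^sub>i N\<^bsub>\<delta>/r\<^sub>i\<^esub>(G) + N\<^sub>\<delta>(C)\<close>. If \<open>N\<^sub>\<delta>(C) \<le> \<delta>\<^sup>-\<^sup>t\<close> for small \<open>\<delta>\<close> and \<open>\<Sum>\<^sub>i r\<^sub>i\<^sup>t < 1\<close>, then a bound \<open>M \<delta>\<^sup>-\<^sup>t\<close>
  reproduces itself once \<open>M\<close> is large, so \<open>G\<close> has upper dimension at most \<open>t\<close>.

  Lower bound (\<open>upper_box_dim_ge_SOSC\<close>): if \<open>\<Sum>\<^sub>i r\<^sub>i\<^sup>t > 1\<close>, then \<open>F\<close> has upper dimension at least \<open>t\<close>.
  Let \<open>U\<close> be the open set of the strong open set condition. Some word \<open>v\<close> satisfies \<open>S\<^sub>v(F) \<subseteq> U\<close>, because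
  \<open>F\<close> meets \<open>U\<close> and long words shrink \<open>F\<close> to small sets. The sets \<open>S\<^sub>w(S\<^sub>v(F))\<close>, with \<open>w\<close> running over the
  words of a fixed length \<open>n\<close>, lie in the disjoint sets \<open>S\<^sub>w(U)\<close>; being compact and finite in
  number, they are a positive distance apart. Below that distance
  \<open>N\<^sub>\<delta>(F) \<ge> \<Sum>\<^sub>w N\<^bsub>\<delta>/\<rho>(w)\<^esub>(F)\<close>, where \<open>\<rho>(w)\<close> is the ratio of \<open>S\<^sub>w S\<^sub>v\<close>. Since
  \<open>\<Sum>\<^sub>w \<rho>(w)\<^sup>t = r\<^sub>v\<^sup>t (\<Sum>\<^sub>i r\<^sub>i\<^sup>t)\<^sup>n\<close> exceeds \<open>1\<close> for large \<open>n\<close>, the lower bound \<open>c \<delta>\<^sup>-\<^sup>t\<close> propagates in the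
  same way (\<open>upper_box_dim_ge_disjoint_copies\<close>).

  Together: every \<open>t\<close> above the dimension of \<open>F\<close> has \<open>\<Sum>\<^sub>i r\<^sub>i\<^sup>t < 1\<close> by the lower bound, so every \<open>t\<close> above
  the dimensions of both \<open>F\<close> and \<open>C\<close> bounds the dimension of \<open>G\<close>. The converse inequality is
  monotonicity, as \<open>F\<close> and \<open>C\<close> are subsets of \<open>G\<close>.
\<close>

section \<open>Covering numbers\<close>

text \<open>
  The diameter condition is phrased through pairwise distances, which makes unions, images and
  preimages of covers immediate; for \<open>0 \<le> \<delta>\<close> it agrees with the condition in \<open>covering_number\<close>.
\<close>

definition small_cover :: "real \<Rightarrow> 'a::metric_space set \<Rightarrow> 'a set set \<Rightarrow> bool" where
  "small_cover \<delta> E \<A> \<longleftrightarrow> finite \<A> \<and> E \<subseteq> \<Union>\<A> \<and> (\<forall>A\<in>\<A>. \<forall>x\<in>A. \<forall>y\<in>A. dist x y \<le> \<delta>)"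

lemma bounded_diameter_le_iff:
  fixes A :: "'a::metric_space set"
  assumes "0 \<le> \<delta>"
  shows "bounded A \<and> diameter A \<le> \<delta> \<longleftrightarrow> (\<forall>x\<in>A. \<forall>y\<in>A. dist x y \<le> \<delta>)"
proof
  assume "bounded A \<and> diameter A \<le> \<delta>"
  then show "\<forall>x\<in>A. \<forall>y\<in>A. dist x y \<le> \<delta>"
    by (meson diameter_bounded_bound order_trans)
next
  assume small: "\<forall>x\<in>A. \<forall>y\<in>A. dist x y \<le> \<delta>"
  then have "bounded A"
    by (meson bounded_def bounded_empty ex_in_conv)
  moreover have "diameter A \<le> \<delta>"
    using small assms by (auto simp: diameter_def intro!: cSUP_least)
  ultimately show "bounded A \<and> diameter A \<le> \<delta>" ..
qed

lemma covering_number_eq_Least: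
  assumes "0 \<le> \<delta>"
  shows "covering_number \<delta> E = (LEAST n. \<exists>\<A>. small_cover \<delta> E \<A> \<and> card \<A> = n)"
  unfolding covering_number_def small_cover_def bounded_diameter_le_iff[OF assms]
  by (intro arg_cong[where f=Least] ext) auto

lemma covering_number_le_card:
  assumes "0 \<le> \<delta>" "small_cover \<delta> E \<A>"
  shows "covering_number \<delta> E \<le> card \<A>"
  unfolding covering_number_eq_Least[OF assms(1)] using assms(2) by (auto intro: Least_le)

lemma obtain_minimal_cover:
  fixes E :: "'a::metric_space set"
  assumes "compact (UNIV :: 'a set)" "0 < \<delta>"
  obtains \<A> where "small_cover \<delta> E \<A>" "card \<A> = covering_number \<delta> E"
proof -
  obtain k where k: "finite k" "UNIV \<subseteq> (\<Union>x\<in>k. ball (x::'a) (\<delta>/2))"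
    using compactE_image[OF assms(1), of UNIV "\<lambda>x. ball x (\<delta>/2)"] assms(2)
    by (metis UNIV_I centre_in_ball half_gt_zero open_ball subsetI UN_I)
  have "dist x y \<le> \<delta>" if "x \<in> ball z (\<delta>/2)" "y \<in> ball z (\<delta>/2)" for x y z :: 'a
    using that dist_triangle3[of x y z] by simp
  then have "small_cover \<delta> E ((\<lambda>x. ball x (\<delta>/2)) ` k)"
    unfolding small_cover_def using k by blast
  then have "\<exists>n. \<exists>\<A>. small_cover \<delta> E \<A> \<and> card \<A> = n" by blast
  from LeastI_ex[OF this] show thesis
    using that covering_number_eq_Least[of \<delta> E] assms(2) by auto
qed

lemma covering_number_mono:
  fixes E :: "'a::metric_space set"
  assumes "compact (UNIV :: 'a set)" "0 < \<delta>" "\<delta> \<le> \<delta>'" "E \<subseteq> E'"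
  shows "covering_number \<delta>' E \<le> covering_number \<delta> E'"
proof -
  obtain \<A> where \<A>: "small_cover \<delta> E' \<A>" "card \<A> = covering_number \<delta> E'"
    using obtain_minimal_cover assms(1,2) by blast
  then have "small_cover \<delta>' E \<A>"
    using assms(3,4) unfolding small_cover_def by (meson order_trans)
  then show ?thesis using covering_number_le_card[of \<delta>'] \<A>(2) assms(2,3) by fastforce
qed

lemma covering_number_ge_1:
  fixes E :: "'a::metric_space set"
  assumes "compact (UNIV :: 'a set)" "0 < \<delta>" "E \<noteq> {}"
  shows "1 \<le> covering_number \<delta> E"
proof -
  obtain \<A> where \<A>: "small_cover \<delta> E \<A>" "card \<A> = covering_number \<delta> E"
    using obtain_minimal_cover assms(1,2) by blast
  then have "\<A> \<noteq> {}" "finite \<A>" using assms(3) unfolding small_cover_def by auto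
  then show ?thesis using \<A>(2) by (metis card_gt_0_iff One_nat_def Suc_le_eq)
qed

lemma covering_number_Un_le:
  fixes E :: "'a::metric_space set"
  assumes "compact (UNIV :: 'a set)" "0 < \<delta>"
  shows "covering_number \<delta> (E \<union> E') \<le> covering_number \<delta> E + covering_number \<delta> E'"
proof -
  obtain \<A> where \<A>: "small_cover \<delta> E \<A>" "card \<A> = covering_number \<delta> E"
    using obtain_minimal_cover assms by blast
  obtain \<B> where \<B>: "small_cover \<delta> E' \<B>" "card \<B> = covering_number \<delta> E'"
    using obtain_minimal_cover assms by blast
  have "small_cover \<delta> (E \<union> E') (\<A> \<union> \<B>)"
    using \<A> \<B> unfolding small_cover_def Union_Un_distrib ball_Un
    by (simp add: le_supI1 le_supI2)
  then have "covering_number \<delta> (E \<union> E') \<le> card (\<A> \<union> \<B>)"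
    using assms(2) by (intro covering_number_le_card) auto
  also have "\<dots> \<le> card \<A> + card \<B>" by (rule card_Un_le)
  finally show ?thesis using \<A> \<B> by simp
qed

lemma covering_number_UN_le:
  fixes E :: "'i \<Rightarrow> 'a::metric_space set"
  assumes "compact (UNIV :: 'a set)" "0 < \<delta>" "finite I"
  shows "covering_number \<delta> (\<Union>i\<in>I. E i) \<le> (\<Sum>i\<in>I. covering_number \<delta> (E i))"
  using assms(3)
proof (induction I)
  case empty
  have "covering_number \<delta> ({} :: 'a set) \<le> card ({} :: 'a set set)"
    using assms(2) by (intro covering_number_le_card) (auto simp: small_cover_def)
  then show ?case by simp
next
  case (insert i I)
  then show ?case
    using covering_number_Un_le[OF assms(1,2), of "E i" "\<Union>i\<in>I. E i"] by simp
qed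

text \<open>
  A set of diameter at most \<open>\<delta>\<close> meets at most one of the \<open>E i\<close>, so a cover of the union splits into
  disjoint subfamilies, one covering each \<open>E i\<close>.
\<close>

lemma covering_number_separated_UN_ge:
  fixes E :: "'i \<Rightarrow> 'a::metric_space set"
  assumes X: "compact (UNIV :: 'a set)" and "0 < \<delta>" and I: "finite I"
    and sep: "\<And>i j x y. i \<in> I \<Longrightarrow> j \<in> I \<Longrightarrow> i \<noteq> j \<Longrightarrow> x \<in> E i \<Longrightarrow> y \<in> E j \<Longrightarrow> \<delta> < dist x y"
  shows "(\<Sum>i\<in>I. covering_number \<delta> (E i)) \<le> covering_number \<delta> (\<Union>i\<in>I. E i)"
proof -
  obtain \<A> where \<A>: "small_cover \<delta> (\<Union>i\<in>I. E i) \<A>"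
      "card \<A> = covering_number \<delta> (\<Union>i\<in>I. E i)"
    using obtain_minimal_cover[OF X \<open>0 < \<delta>\<close>] by blast
  define \<B> where "\<B> i = {A \<in> \<A>. A \<inter> E i \<noteq> {}}" for i
  have fin: "finite \<A>" using \<A> unfolding small_cover_def by blast
  have cov: "small_cover \<delta> (E i) (\<B> i)" if "i \<in> I" for i
  proof -
    have "E i \<subseteq> \<Union>\<A>" using \<A>(1) that unfolding small_cover_def by auto
    then have "E i \<subseteq> \<Union>(\<B> i)" unfolding \<B>_def by blast
    then show ?thesis using \<A>(1) unfolding small_cover_def \<B>_def by auto
  qed
  have "(\<Sum>i\<in>I. covering_number \<delta> (E i)) \<le> (\<Sum>i\<in>I. card (\<B> i))"
    using \<open>0 < \<delta>\<close> cov by (intro sum_mono covering_number_le_card) simp_all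
  also have "\<dots> = card (\<Union>i\<in>I. \<B> i)"
  proof (rule card_UN_disjoint[symmetric])
    show "\<forall>i\<in>I. \<forall>j\<in>I. i \<noteq> j \<longrightarrow> \<B> i \<inter> \<B> j = {}"
    proof (intro ballI impI equals0I)
      fix i j A assume ij: "i \<in> I" "j \<in> I" "i \<noteq> j" and "A \<in> \<B> i \<inter> \<B> j"
      then obtain x y where "A \<in> \<A>" "x \<in> A" "x \<in> E i" "y \<in> A" "y \<in> E j"
        unfolding \<B>_def by blast
      moreover have "dist x y \<le> \<delta>"
        using calculation \<A>(1) unfolding small_cover_def by blast
      ultimately show False using sep[of i j x y] ij by simp
    qed
  qed (use I fin in \<open>auto simp: \<B>_def\<close>)
  also have "\<dots> \<le> card \<A>" by (rule card_mono) (use fin in \<open>auto simp: \<B>_def\<close>)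
  finally show ?thesis using \<A> by simp
qed

section \<open>Similarities\<close>

definition similarity :: "real \<Rightarrow> ('a::metric_space \<Rightarrow> 'a) \<Rightarrow> bool" where
  "similarity \<rho> T \<longleftrightarrow> 0 < \<rho> \<and> (\<forall>x y. dist (T x) (T y) = \<rho> * dist x y)"

lemma similarity_inj: "similarity \<rho> T \<Longrightarrow> T x = T y \<Longrightarrow> x = y"
  unfolding similarity_def by (metis dist_eq_0_iff mult_eq_0_iff less_irrefl)

lemma similarity_compose: "similarity \<rho> T \<Longrightarrow> similarity \<sigma> V \<Longrightarrow> similarity (\<rho> * \<sigma>) (\<lambda>x. T (V x))"
  unfolding similarity_def by simp

lemma similarity_compact_image:
  assumes "similarity \<rho> T" "compact F"
  shows "compact (T ` F)"
proof -
  have "\<rho>-lipschitz_on F T"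
    using assms(1) unfolding similarity_def by (intro lipschitz_onI) auto
  then show ?thesis using assms(2) by (intro compact_continuous_image lipschitz_on_continuous_on)
qed

text \<open>
  Push covers forward along \<open>T\<close> for one inequality and pull them back for the other.
\<close>

lemma covering_number_similarity_image:
  fixes E :: "'a::metric_space set"
  assumes X: "compact (UNIV :: 'a set)" and \<delta>: "0 < \<delta>" and T: "similarity \<rho> T"
  shows "covering_number \<delta> (T ` E) = covering_number (\<delta> / \<rho>) E"
proof (rule antisym)
  have \<rho>: "0 < \<rho>" "dist (T x) (T y) = \<rho> * dist x y" for x y
    using T unfolding similarity_def by auto
  obtain \<A> where \<A>: "small_cover (\<delta> / \<rho>) E \<A>" "card \<A> = covering_number (\<delta> / \<rho>) E"
    using obtain_minimal_cover[OF X] \<delta> \<rho>(1) by (metis divide_pos_pos)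
  have "small_cover \<delta> (T ` E) ((`) T ` \<A>)"
    using \<A>(1) \<rho>(1) unfolding small_cover_def image_Union[symmetric]
    by (simp add: \<rho>(2) image_mono pos_le_divide_eq mult.commute)
  then have "covering_number \<delta> (T ` E) \<le> card ((`) T ` \<A>)"
    using \<delta> by (intro covering_number_le_card) auto
  also have "\<dots> \<le> card \<A>" using \<A>(1) unfolding small_cover_def by (intro card_image_le) auto
  finally show "covering_number \<delta> (T ` E) \<le> covering_number (\<delta> / \<rho>) E" using \<A> by simp
  obtain \<B> where \<B>: "small_cover \<delta> (T ` E) \<B>" "card \<B> = covering_number \<delta> (T ` E)"
    using obtain_minimal_cover[OF X \<delta>] by blast
  have "small_cover (\<delta> / \<rho>) E ((-`) T ` \<B>)"
    using \<B>(1) \<rho>(1) unfolding small_cover_def vimage_Union[symmetric] image_subset_iff_subset_vimage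
    by (simp add: \<rho>(2)[symmetric] pos_le_divide_eq mult.commute)
  then have "covering_number (\<delta> / \<rho>) E \<le> card ((-`) T ` \<B>)"
    using \<delta> \<rho> by (intro covering_number_le_card) auto
  also have "\<dots> \<le> card \<B>" using \<B>(1) unfolding small_cover_def by (intro card_image_le) auto
  finally show "covering_number (\<delta> / \<rho>) E \<le> covering_number \<delta> (T ` E)" using \<B> by simp
qed

section \<open>Box dimension and power laws\<close>

lemma upper_box_dim_mono:
  fixes E :: "'a::metric_space set"
  assumes X: "compact (UNIV :: 'a set)" and "E \<subseteq> E'" "E \<noteq> {}"
  shows "upper_box_dim E \<le> upper_box_dim E'"
  unfolding upper_box_dim_def
proof (rule Limsup_mono)
  have "\<forall>\<^sub>F \<delta> in at_right (0::real). 0 < \<delta> \<and> \<delta> < 1"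
    unfolding eventually_at_right_field by (intro exI[of _ 1]) auto
  then show "\<forall>\<^sub>F \<delta> in at_right 0. ereal (ln (real (covering_number \<delta> E)) / - ln \<delta>)
      \<le> ereal (ln (real (covering_number \<delta> E')) / - ln \<delta>)"
  proof eventually_elim
    case (elim \<delta>)
    have "covering_number \<delta> E \<le> covering_number \<delta> E'" "1 \<le> covering_number \<delta> E"
      using covering_number_mono[OF X, of \<delta> \<delta>] covering_number_ge_1[OF X] elim assms by auto
    then have "ln (real (covering_number \<delta> E)) \<le> ln (real (covering_number \<delta> E'))" by simp
    moreover have "0 < - ln \<delta>" using elim by simp
    ultimately show ?case by (simp only: ereal_less_eq divide_right_mono less_imp_le)
  qed
qed

text \<open>
  The constant \<open>M\<close> contributes \<open>ln M / (- ln \<delta>)\<close>, which vanishes in the limit: only the exponent of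
  a power law is visible to the box dimension.
\<close>

lemma tendsto_log_power_law:
  fixes M t :: real
  assumes "0 < M"
  shows "((\<lambda>\<delta>. ln (M * \<delta> powr (-t)) / (- ln \<delta>)) \<longlongrightarrow> t) (at_right 0)"
proof -
  have "filterlim (\<lambda>\<delta>. - ln \<delta>) at_infinity (at_right (0::real))"
    using ln_at_0 by (intro filterlim_at_top_imp_at_infinity) (simp add: filterlim_uminus_at_top)
  then have "((\<lambda>\<delta>. t + ln M / (- ln \<delta>)) \<longlongrightarrow> t + 0) (at_right 0)"
    by (intro tendsto_add tendsto_const) (rule tendsto_divide_0[OF tendsto_const])
  moreover have "\<forall>\<^sub>F \<delta> in at_right (0::real). 0 < \<delta> \<and> \<delta> < 1"
    unfolding eventually_at_right_field by (intro exI[of _ 1]) auto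
  then have "\<forall>\<^sub>F \<delta> in at_right 0. t + ln M / (- ln \<delta>) = ln (M * \<delta> powr (-t)) / (- ln \<delta>)"
  proof eventually_elim
    case (elim \<delta>)
    then have "ln \<delta> < 0" by simp
    then show ?case using elim assms by (simp add: ln_mult ln_powr field_simps)
  qed
  ultimately show ?thesis by (simp add: filterlim_cong[OF refl refl])
qed

lemma upper_box_dim_le_power_law:
  fixes E :: "'a::metric_space set"
  assumes X: "compact (UNIV :: 'a set)" and "E \<noteq> {}" "0 < \<epsilon>"
    and le: "\<And>\<delta>. 0 < \<delta> \<Longrightarrow> \<delta> < \<epsilon> \<Longrightarrow> real (covering_number \<delta> E) \<le> M * \<delta> powr (-t)"
  shows "upper_box_dim E \<le> ereal t"
proof -
  have pos: "1 \<le> covering_number \<delta> E" if "0 < \<delta>" for \<delta>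
    using covering_number_ge_1[OF X that \<open>E \<noteq> {}\<close>] .
  have "0 < M * (\<epsilon>/2) powr (-t)"
    using le[of "\<epsilon>/2"] pos[of "\<epsilon>/2"] \<open>0 < \<epsilon>\<close> by simp
  then have M: "0 < M" by (simp add: zero_less_mult_iff)
  have "\<forall>\<^sub>F \<delta> in at_right (0::real). 0 < \<delta> \<and> \<delta> < \<epsilon> \<and> \<delta> < 1"
    unfolding eventually_at_right_field using \<open>0 < \<epsilon>\<close> by (intro exI[of _ "min \<epsilon> 1"]) auto
  then have ev: "\<forall>\<^sub>F \<delta> in at_right 0. ereal (ln (real (covering_number \<delta> E)) / - ln \<delta>)
      \<le> ereal (ln (M * \<delta> powr (-t)) / - ln \<delta>)"
  proof eventually_elim
    case (elim \<delta>)
    then have "ln (real (covering_number \<delta> E)) \<le> ln (M * \<delta> powr (-t))"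
      using le[of \<delta>] pos[of \<delta>] by (intro ln_mono) auto
    moreover have "0 < - ln \<delta>" using elim by simp
    ultimately show ?case by (simp only: ereal_less_eq divide_right_mono less_imp_le)
  qed
  have "((\<lambda>\<delta>. ereal (ln (M * \<delta> powr (-t)) / - ln \<delta>)) \<longlongrightarrow> ereal t) (at_right 0)"
    using tendsto_log_power_law[OF M] by (rule tendsto_ereal)
  then have "Limsup (at_right 0) (\<lambda>\<delta>. ereal (ln (M * \<delta> powr (-t)) / - ln \<delta>)) = ereal t"
    by (intro lim_imp_Limsup) auto
  then show ?thesis using Limsup_mono[OF ev] unfolding upper_box_dim_def by simp
qed

lemma upper_box_dim_ge_power_law:
  fixes E :: "'a::metric_space set"
  assumes "0 < \<epsilon>" "0 < c"
    and ge: "\<And>\<delta>. 0 < \<delta> \<Longrightarrow> \<delta> < \<epsilon> \<Longrightarrow> c * \<delta> powr (-t) \<le> real (covering_number \<delta> E)"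
  shows "ereal t \<le> upper_box_dim E"
proof -
  have "\<forall>\<^sub>F \<delta> in at_right (0::real). 0 < \<delta> \<and> \<delta> < \<epsilon> \<and> \<delta> < 1"
    unfolding eventually_at_right_field using \<open>0 < \<epsilon>\<close> by (intro exI[of _ "min \<epsilon> 1"]) auto
  then have ev: "\<forall>\<^sub>F \<delta> in at_right 0. ereal (ln (c * \<delta> powr (-t)) / - ln \<delta>)
      \<le> ereal (ln (real (covering_number \<delta> E)) / - ln \<delta>)"
  proof eventually_elim
    case (elim \<delta>)
    then have "ln (c * \<delta> powr (-t)) \<le> ln (real (covering_number \<delta> E))"
      using ge[of \<delta>] assms(2) by (intro ln_mono) auto
    moreover have "0 < - ln \<delta>" using elim by simp
    ultimately show ?case by (simp only: ereal_less_eq divide_right_mono less_imp_le)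
  qed
  have "((\<lambda>\<delta>. ereal (ln (c * \<delta> powr (-t)) / - ln \<delta>)) \<longlongrightarrow> ereal t) (at_right 0)"
    using tendsto_log_power_law[OF assms(2)] by (rule tendsto_ereal)
  then have "Limsup (at_right 0) (\<lambda>\<delta>. ereal (ln (c * \<delta> powr (-t)) / - ln \<delta>)) = ereal t"
    by (intro lim_imp_Limsup) auto
  then show ?thesis using Limsup_mono[OF ev] unfolding upper_box_dim_def by simp
qed

lemma upper_box_dim_less_imp_power_law:
  fixes E :: "'a::metric_space set"
  assumes X: "compact (UNIV :: 'a set)" and "E \<noteq> {}" "upper_box_dim E < ereal t"
  obtains \<epsilon> where "0 < \<epsilon>"
    "\<And>\<delta>. 0 < \<delta> \<Longrightarrow> \<delta> < \<epsilon> \<Longrightarrow> real (covering_number \<delta> E) \<le> \<delta> powr (-t)"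
proof -
  have "\<forall>\<^sub>F \<delta> in at_right 0. ereal (ln (real (covering_number \<delta> E)) / - ln \<delta>) < ereal t"
    using assms(3) unfolding upper_box_dim_def by (rule Limsup_lessD)
  then obtain \<epsilon> where \<epsilon>: "0 < \<epsilon>"
    "\<And>\<delta>. 0 < \<delta> \<Longrightarrow> \<delta> < \<epsilon> \<Longrightarrow> ln (real (covering_number \<delta> E)) / - ln \<delta> < t"
    unfolding eventually_at_right_field by auto
  have "real (covering_number \<delta> E) \<le> \<delta> powr (-t)" if "0 < \<delta>" "\<delta> < min \<epsilon> 1" for \<delta>
  proof -
    have "0 < - ln \<delta>" using that by simp
    then have "ln (real (covering_number \<delta> E)) \<le> ln (\<delta> powr (-t))"
      using \<epsilon>(2)[of \<delta>] that by (simp add: ln_powr field_simps)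
    moreover have "0 < real (covering_number \<delta> E)" "0 < \<delta> powr (-t)"
      using covering_number_ge_1[OF X _ \<open>E \<noteq> {}\<close>, of \<delta>] that by auto
    ultimately show ?thesis by (metis ln_le_cancel_iff)
  qed
  then show thesis using that[of "min \<epsilon> 1"] \<epsilon>(1) by simp
qed

lemma upper_box_dim_nonneg:
  fixes E :: "'a::metric_space set"
  assumes "compact (UNIV :: 'a set)" "E \<noteq> {}"
  shows "0 \<le> upper_box_dim E"
  using upper_box_dim_ge_power_law[of 1 1 0 E] covering_number_ge_1[OF assms(1) _ assms(2)]
  by (fastforce simp: zero_ereal_def)

section \<open>Functional inequalities for covering numbers\<close>

text \<open>
  A functional inequality relates the scale \<open>\<delta>\<close> to the scales \<open>\<delta> / \<rho>\<close> with \<open>\<rho> \<le> q < 1\<close>. Each appeal to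
  it coarsens the scale by a factor of at least \<open>1 / q\<close>, so finitely many appeals reach \<open>\<eta>\<close>.
\<close>

lemma scale_induct [consumes 4, case_names coarse fine]:
  fixes \<delta> \<eta> q :: real
  assumes "0 < q" "q < 1" "0 < \<eta>" "0 < \<delta>"
    and coarse: "\<And>\<delta>. \<eta> \<le> \<delta> \<Longrightarrow> P \<delta>"
    and fine: "\<And>\<delta>. 0 < \<delta> \<Longrightarrow> \<delta> < \<eta> \<Longrightarrow> (\<And>\<delta>'. \<delta> / q \<le> \<delta>' \<Longrightarrow> P \<delta>') \<Longrightarrow> P \<delta>"
  shows "P \<delta>"
proof -
  have "\<forall>\<delta>\<ge>\<eta> * q ^ n. P \<delta>" for n
  proof (induction n)
    case 0
    then show ?case using coarse by simp
  next
    case (Suc n)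
    show ?case
    proof (intro allI impI)
      fix \<delta> assume \<delta>: "\<eta> * q ^ Suc n \<le> \<delta>"
      have "0 < \<eta> * q ^ Suc n" using assms by simp
      then have "0 < \<delta>" using \<delta> by linarith
      have "\<eta> * q ^ n \<le> \<delta> / q" using \<delta> assms by (simp add: field_simps)
      then have "P \<delta>'" if "\<delta> / q \<le> \<delta>'" for \<delta>' using Suc that by (meson order_trans)
      then show "P \<delta>" using coarse fine[OF \<open>0 < \<delta>\<close>] by (meson not_le)
    qed
  qed
  moreover obtain n where "q ^ n < \<delta> / \<eta>"
    using real_arch_pow_inv[of "\<delta> / \<eta>" q] assms by auto
  then have "\<eta> * q ^ n \<le> \<delta>" using assms by (simp add: field_simps)
  ultimately show ?thesis by blast
qed

lemma powr_minus_divide: "0 < \<delta> \<Longrightarrow> 0 < \<rho> \<Longrightarrow> (\<delta> / \<rho>) powr (-t) = \<rho> powr t * \<delta> powr (-t)"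
  for \<delta> \<rho> t :: real
  by (simp add: powr_divide powr_minus field_simps)

lemma uniform_ratio_bound:
  fixes \<rho> :: "'i \<Rightarrow> real"
  assumes "finite I" "\<And>i. i \<in> I \<Longrightarrow> \<rho> i < 1"
  obtains q where "0 < q" "q < 1" "\<And>i. i \<in> I \<Longrightarrow> \<rho> i \<le> q"
proof
  have f: "finite (insert (1/2) (\<rho> ` I))" using assms by simp
  show "Max (insert (1/2) (\<rho> ` I)) < 1" using f assms by (subst Max_less_iff) auto
  have "1/2 \<le> Max (insert (1/2) (\<rho> ` I))" by (rule Max_ge[OF f]) simp
  then show "0 < Max (insert (1/2) (\<rho> ` I))" by linarith
  show "\<rho> i \<le> Max (insert (1/2) (\<rho> ` I))" if "i \<in> I" for i
    using that by (intro Max_ge[OF f]) simp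
qed

text \<open>
  The induction proves \<open>N\<^sub>\<delta>(F) \<le> M \<delta>\<^sup>-\<^sup>t\<close>. With \<open>s = \<Sum>\<^sub>i \<rho>\<^sub>i\<^sup>t\<close>, the functional inequality turns the
  bound \<open>M \<delta>\<^sup>-\<^sup>t\<close> at coarser scales into \<open>(M s + 1) \<delta>\<^sup>-\<^sup>t\<close> at scale \<open>\<delta>\<close>, and \<open>s < 1\<close> leaves room to
  absorb the contribution \<open>1\<close> of the condensation set.
\<close>

lemma upper_box_dim_inhomogeneous_le:
  fixes F C :: "'a::metric_space set" and T :: "'i \<Rightarrow> 'a \<Rightarrow> 'a"
  assumes X: "compact (UNIV :: 'a set)" and I: "finite I"
    and T: "\<And>i. i \<in> I \<Longrightarrow> similarity (\<rho> i) (T i)" and \<rho>: "\<And>i. i \<in> I \<Longrightarrow> \<rho> i < 1"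
    and F: "F \<subseteq> (\<Union>i\<in>I. T i ` F) \<union> C" and "F \<noteq> {}" "C \<noteq> {}"
    and t: "0 \<le> t" "(\<Sum>i\<in>I. \<rho> i powr t) < 1" "upper_box_dim C < ereal t"
  shows "upper_box_dim F \<le> ereal t"
proof -
  have pos: "0 < \<rho> i" if "i \<in> I" for i using T[OF that] unfolding similarity_def by simp
  obtain q where q: "0 < q" "q < 1" "\<And>i. i \<in> I \<Longrightarrow> \<rho> i \<le> q"
    using uniform_ratio_bound[of I \<rho>] I \<rho> by metis
  obtain \<eta> where \<eta>: "0 < \<eta>"
    "\<And>\<delta>. 0 < \<delta> \<Longrightarrow> \<delta> < \<eta> \<Longrightarrow> real (covering_number \<delta> C) \<le> \<delta> powr (-t)"
    using upper_box_dim_less_imp_power_law[OF X \<open>C \<noteq> {}\<close> t(3)] by metis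
  define m where "m = Min (insert 1 (\<rho> ` I))"
  have m: "0 < m" "\<And>i. i \<in> I \<Longrightarrow> m \<le> \<rho> i"
    unfolding m_def using I pos by (auto simp: Min_gr_iff)
  define s where "s = (\<Sum>i\<in>I. \<rho> i powr t)"
  (* The bound cannot hold at arbitrarily coarse scales, where its right-hand side tends to 0 for
     t > 0. It is claimed up to R, the coarsest scale that one step from below \<eta> can reach. *)
  define R where "R = \<eta> / m"
  (* The first entry covers the scales between \<eta> and R, the second gives M s + 1 \<le> M. *)
  define M where "M = max (covering_number \<eta> F * R powr t) (1 / (1 - s))"
  have "0 < R" using \<eta> m by (simp add: R_def)
  have M: "M * s + 1 \<le> M"
  proof -
    have "1 / (1 - s) \<le> M" "0 < 1 - s" using t(2) by (auto simp: M_def s_def)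
    then show ?thesis by (simp add: field_simps)
  qed
  have "0 < \<delta> \<and> \<delta> \<le> R \<longrightarrow> real (covering_number \<delta> F) \<le> M * \<delta> powr (-t)" if "0 < \<delta>" for \<delta>
    using q(1,2) \<eta>(1) that
  proof (induction \<delta> rule: scale_induct)
    case (coarse \<delta>)
    show ?case
    proof
      assume \<delta>: "0 < \<delta> \<and> \<delta> \<le> R"
      have "real (covering_number \<delta> F) \<le> real (covering_number \<eta> F) * 1"
        using covering_number_mono[OF X \<eta>(1) coarse, of F F] by simp
      also have "\<dots> \<le> real (covering_number \<eta> F) * (R powr t * \<delta> powr (-t))"
      proof (intro mult_left_mono)
        have "\<delta> powr t \<le> R powr t" using \<delta> t(1) by (intro powr_mono2) auto
        then show "1 \<le> R powr t * \<delta> powr (-t)" using \<delta> by (simp add: powr_minus field_simps)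
      qed simp
      also have "\<dots> \<le> M * \<delta> powr (-t)"
        unfolding mult.assoc[symmetric] by (intro mult_right_mono) (auto simp: M_def)
      finally show "real (covering_number \<delta> F) \<le> M * \<delta> powr (-t)" .
    qed
  next
    case (fine \<delta>)
    have "covering_number \<delta> F \<le> covering_number \<delta> ((\<Union>i\<in>I. T i ` F) \<union> C)"
      using covering_number_mono[OF X fine(1) order_refl F] .
    also have "\<dots> \<le> covering_number \<delta> (\<Union>i\<in>I. T i ` F) + covering_number \<delta> C"
      by (rule covering_number_Un_le[OF X fine(1)])
    also have "\<dots> \<le> (\<Sum>i\<in>I. covering_number \<delta> (T i ` F)) + covering_number \<delta> C"
      using covering_number_UN_le[OF X fine(1) I] by simp
    also have "(\<Sum>i\<in>I. covering_number \<delta> (T i ` F)) = (\<Sum>i\<in>I. covering_number (\<delta> / \<rho> i) F)"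
      using covering_number_similarity_image[OF X fine(1) T] by simp
    finally have "real (covering_number \<delta> F)
        \<le> (\<Sum>i\<in>I. real (covering_number (\<delta> / \<rho> i) F)) + covering_number \<delta> C"
      by (metis of_nat_add of_nat_le_iff of_nat_sum)
    also have "\<dots> \<le> (\<Sum>i\<in>I. M * (\<rho> i powr t * \<delta> powr (-t))) + \<delta> powr (-t)"
    proof (intro add_mono sum_mono)
      fix i assume i: "i \<in> I"
      have "\<delta> / q \<le> \<delta> / \<rho> i" using q(3)[OF i] pos[OF i] fine(1) by (simp add: frac_le)
      moreover have "\<delta> / \<rho> i \<le> R"
        unfolding R_def using m(1) m(2)[OF i] fine(1,2) by (intro frac_le) auto
      ultimately have "real (covering_number (\<delta> / \<rho> i) F) \<le> M * (\<delta> / \<rho> i) powr (-t)"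
        using fine(1,3) pos[OF i] by simp
      then show "real (covering_number (\<delta> / \<rho> i) F) \<le> M * (\<rho> i powr t * \<delta> powr (-t))"
        using powr_minus_divide[OF fine(1) pos[OF i]] by simp
    qed (rule \<eta>(2)[OF fine(1,2)])
    also have "\<dots> = (M * s + 1) * \<delta> powr (-t)"
      by (simp add: s_def sum_distrib_left sum_distrib_right algebra_simps)
    also have "\<dots> \<le> M * \<delta> powr (-t)" using M by (intro mult_right_mono) auto
    finally show ?case by blast
  qed
  then show ?thesis
    by (intro upper_box_dim_le_power_law[OF X \<open>F \<noteq> {}\<close> \<open>0 < R\<close>, of M]) auto
qed

lemma compact_disjoint_gap:
  fixes A B :: "'a::metric_space set"
  assumes "compact A" "compact B" "A \<inter> B = {}"
  obtains \<eta> where "0 < \<eta>" "\<And>x y. x \<in> A \<Longrightarrow> y \<in> B \<Longrightarrow> \<eta> \<le> dist x y"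
proof (cases "A = {} \<or> B = {}")
  case True
  then show ?thesis using that[of 1] by auto
next
  case False
  then have "A \<times> B \<noteq> {}" by auto
  moreover have "continuous_on (A \<times> B) (\<lambda>p. dist (fst p) (snd p))"
    by (intro continuous_intros)
  ultimately obtain p
    where p: "p \<in> A \<times> B" "\<forall>p'\<in>A \<times> B. dist (fst p) (snd p) \<le> dist (fst p') (snd p')"
    using continuous_attains_inf[OF compact_Times[OF assms(1,2)]] by blast
  then have "0 < dist (fst p) (snd p)" using assms(3) by auto
  moreover have "dist (fst p) (snd p) \<le> dist x y" if "x \<in> A" "y \<in> B" for x y
    using bspec[OF p(2), of "(x, y)"] that by simp
  ultimately show ?thesis by (rule that)
qed

lemma finite_compact_disjoint_gap:
  fixes E :: "'i \<Rightarrow> 'a::metric_space set"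
  assumes "finite I" "\<And>i. i \<in> I \<Longrightarrow> compact (E i)" "disjoint_family_on E I"
  obtains \<eta> where "0 < \<eta>"
    "\<And>i j x y. i \<in> I \<Longrightarrow> j \<in> I \<Longrightarrow> i \<noteq> j \<Longrightarrow> x \<in> E i \<Longrightarrow> y \<in> E j \<Longrightarrow> \<eta> \<le> dist x y"
proof -
  define J where "J = {p \<in> I \<times> I. fst p \<noteq> snd p}"
  have "\<forall>p\<in>J. \<exists>\<eta>>0. \<forall>x\<in>E (fst p). \<forall>y\<in>E (snd p). \<eta> \<le> dist x y"
  proof
    fix p assume "p \<in> J"
    then have p: "fst p \<in> I" "snd p \<in> I" "fst p \<noteq> snd p" unfolding J_def by auto
    then have "E (fst p) \<inter> E (snd p) = {}"
      using assms(3) unfolding disjoint_family_on_def by blast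
    with assms(2)[OF p(1)] assms(2)[OF p(2)]
    show "\<exists>\<eta>>0. \<forall>x\<in>E (fst p). \<forall>y\<in>E (snd p). \<eta> \<le> dist x y"
      by (rule compact_disjoint_gap) blast
  qed
  then obtain g where g: "\<And>p. p \<in> J \<Longrightarrow> 0 < g p"
      "\<And>p x y. p \<in> J \<Longrightarrow> x \<in> E (fst p) \<Longrightarrow> y \<in> E (snd p) \<Longrightarrow> g p \<le> dist x y"
    by metis
  have fin: "finite (insert 1 (g ` J))" using assms(1) unfolding J_def by simp
  show thesis
  proof
    show "0 < Min (insert 1 (g ` J))" using fin g(1) by (subst Min_gr_iff) auto
    fix i j x y assume ij: "i \<in> I" "j \<in> I" "i \<noteq> j" "x \<in> E i" "y \<in> E j"
    then have J: "(i, j) \<in> J" by (simp add: J_def)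
    then have "Min (insert 1 (g ` J)) \<le> g (i, j)" using fin by (intro Min_le) auto
    also have "\<dots> \<le> dist x y" using g(2)[OF J] ij by simp
    finally show "Min (insert 1 (g ` J)) \<le> dist x y" .
  qed
qed

text \<open>
  At scales below the gap \<open>\<eta>\<close> between the copies, the covering number of \<open>F\<close> is at least the sum of
  those of the copies, and \<open>1 \<le> \<Sum>\<^sub>i \<rho>\<^sub>i\<^sup>t\<close> makes the lower bound \<open>(\<eta> / \<delta>)\<^sup>t\<close> reproduce itself. At
  coarser scales this bound is at most \<open>1\<close>, hence trivial.
\<close>

lemma upper_box_dim_ge_disjoint_copies:
  fixes F :: "'a::metric_space set" and T :: "'i \<Rightarrow> 'a \<Rightarrow> 'a"
  assumes X: "compact (UNIV :: 'a set)" and I: "finite I"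
    and T: "\<And>i. i \<in> I \<Longrightarrow> similarity (\<rho> i) (T i)" and \<rho>: "\<And>i. i \<in> I \<Longrightarrow> \<rho> i < 1"
    and F: "compact F" "F \<noteq> {}" "(\<Union>i\<in>I. T i ` F) \<subseteq> F"
    and disj: "disjoint_family_on (\<lambda>i. T i ` F) I"
    and t: "0 \<le> t" "1 \<le> (\<Sum>i\<in>I. \<rho> i powr t)"
  shows "ereal t \<le> upper_box_dim F"
proof -
  have pos: "0 < \<rho> i" if "i \<in> I" for i using T[OF that] unfolding similarity_def by simp
  obtain q where q: "0 < q" "q < 1" "\<And>i. i \<in> I \<Longrightarrow> \<rho> i \<le> q"
    using uniform_ratio_bound[of I \<rho>] I \<rho> by metis
  obtain \<eta> where \<eta>: "0 < \<eta>" "\<And>i j x y. i \<in> I \<Longrightarrow> j \<in> I \<Longrightarrow> i \<noteq> j \<Longrightarrow>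
      x \<in> T i ` F \<Longrightarrow> y \<in> T j ` F \<Longrightarrow> \<eta> \<le> dist x y"
  proof (rule finite_compact_disjoint_gap[OF I _ disj])
    show "compact (T i ` F)" if "i \<in> I" for i
      using similarity_compact_image[OF T[OF that] F(1)] .
  qed (rule that)
  have "\<eta> powr t * \<delta> powr (-t) \<le> covering_number \<delta> F" if "0 < \<delta>" for \<delta>
    using q(1,2) \<eta>(1) that
  proof (induction \<delta> rule: scale_induct)
    case (coarse \<delta>)
    then have "\<eta> powr t \<le> \<delta> powr t" using \<eta>(1) t(1) by (intro powr_mono2) auto
    then have "\<eta> powr t * \<delta> powr (-t) \<le> 1"
      using coarse \<eta>(1) by (simp add: powr_minus field_simps)
    then show ?case using covering_number_ge_1[OF X _ F(2), of \<delta>] coarse \<eta>(1) by linarith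
  next
    case (fine \<delta>)
    have "\<eta> powr t * \<delta> powr (-t) * 1 \<le> \<eta> powr t * \<delta> powr (-t) * (\<Sum>i\<in>I. \<rho> i powr t)"
      using t(2) by (intro mult_left_mono) auto
    also have "\<dots> = (\<Sum>i\<in>I. \<eta> powr t * (\<delta> / \<rho> i) powr (-t))"
      using powr_minus_divide[OF fine(1) pos] by (simp add: sum_distrib_left algebra_simps)
    also have "\<dots> \<le> (\<Sum>i\<in>I. real (covering_number (\<delta> / \<rho> i) F))"
    proof (rule sum_mono)
      fix i assume i: "i \<in> I"
      have "\<delta> / q \<le> \<delta> / \<rho> i" using q(3)[OF i] pos[OF i] fine(1) by (simp add: frac_le)
      then show "\<eta> powr t * (\<delta> / \<rho> i) powr (-t) \<le> real (covering_number (\<delta> / \<rho> i) F)"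
        by (rule fine(3))
    qed
    also have "\<dots> = real (\<Sum>i\<in>I. covering_number \<delta> (T i ` F))"
      using covering_number_similarity_image[OF X fine(1) T] by simp
    also have "(\<Sum>i\<in>I. covering_number \<delta> (T i ` F)) \<le> covering_number \<delta> (\<Union>i\<in>I. T i ` F)"
      using \<eta>(2) fine(2) by (intro covering_number_separated_UN_ge[OF X fine(1) I]) force
    also have "\<dots> \<le> covering_number \<delta> F"
      by (rule covering_number_mono[OF X fine(1) order_refl F(3)])
    finally show ?case by simp
  qed
  then show ?thesis
    using \<eta>(1) by (intro upper_box_dim_ge_power_law[of 1 "\<eta> powr t"]) auto
qed

section \<open>Words and the strong open set condition\<close>

abbreviation words :: "'i set \<Rightarrow> nat \<Rightarrow> 'i list set" where
  "words I n \<equiv> {w. set w \<subseteq> I \<and> length w = n}"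

lemma similarity_word:
  assumes "\<And>i. i \<in> I \<Longrightarrow> similarity (r i) (S i)" "set w \<subseteq> I"
  shows "similarity (prod_list (map r w)) (foldr S w)"
  using assms(2)
proof (induction w)
  case Nil
  then show ?case by (simp add: similarity_def)
next
  case (Cons i w)
  then have "similarity (r i * prod_list (map r w)) (\<lambda>x. S i (foldr S w x))"
    using assms(1) by (intro similarity_compose) simp_all
  then show ?case by (simp add: comp_def)
qed

lemma prod_list_le_power:
  fixes r :: "'i \<Rightarrow> real"
  assumes "\<And>i. i \<in> I \<Longrightarrow> 0 < r i \<and> r i \<le> q" "set w \<subseteq> I"
  shows "0 < prod_list (map r w)" "prod_list (map r w) \<le> q ^ length w"
  using assms(2)
proof (induction w)
  case (Cons i w)
  { case 1 then show ?case using Cons(1) assms(1)[of i] by simp }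
  { case 2 then show ?case using Cons(1,2) assms(1)[of i] by (auto intro!: mult_mono) }
qed simp_all

lemma sum_words_powr:
  fixes r :: "'i \<Rightarrow> real"
  assumes "finite I" "\<And>i. i \<in> I \<Longrightarrow> 0 < r i"
  shows "(\<Sum>w\<in>words I n. prod_list (map r w) powr t) = (\<Sum>i\<in>I. r i powr t) ^ n"
proof (induction n)
  case 0
  have "words I 0 = {[]}" by auto
  then show ?case by simp
next
  case (Suc n)
  have pos: "0 < prod_list (map r w)" if "set w \<subseteq> I" for w
    using that assms(2) by (induction w) auto
  have "(\<Sum>w\<in>words I (Suc n). prod_list (map r w) powr t)
      = (\<Sum>(w, i)\<in>words I n \<times> I. (r i * prod_list (map r w)) powr t)"
    unfolding lists_length_Suc_eq
    by (subst sum.reindex) (auto simp: inj_on_def case_prod_unfold)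
  also have "\<dots> = (\<Sum>(w, i)\<in>words I n \<times> I. prod_list (map r w) powr t * r i powr t)"
    using assms(2) pos by (intro sum.cong) (auto simp: powr_mult less_imp_le)
  also have "\<dots> = (\<Sum>i\<in>I. r i powr t) ^ Suc n"
    unfolding sum.cartesian_product[symmetric] sum_product[symmetric] Suc by (simp add: mult.commute)
  finally show ?case .
qed

lemma foldr_image_subset:
  assumes "(\<Union>i\<in>I. S i ` U) \<subseteq> U" "set w \<subseteq> I"
  shows "foldr S w ` U \<subseteq> U"
  using assms(2)
proof (induction w)
  case (Cons i w)
  then have "S i ` (foldr S w ` U) \<subseteq> S i ` U" "i \<in> I" by auto
  then show ?case using assms(1) by (auto simp: image_image)
qed simp

text \<open>
  Two different words of equal length are separated at the first letter in which they differ: up to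
  there they apply the same injective map, and from there on their images lie in disjoint sets
  \<open>S i ` U\<close>.
\<close>

lemma disjoint_family_words:
  assumes S: "\<And>i. i \<in> I \<Longrightarrow> inj (S i)"
    and U: "(\<Union>i\<in>I. S i ` U) \<subseteq> U" "disjoint_family_on (\<lambda>i. S i ` U) I"
  shows "disjoint_family_on (\<lambda>w. foldr S w ` U) (words I n)"
proof (induction n)
  case 0
  then show ?case by (auto simp: disjoint_family_on_def)
next
  case (Suc n)
  show ?case
    unfolding disjoint_family_on_def
  proof (intro ballI impI equals0I)
    fix w w' z assume w: "w \<in> words I (Suc n)" "w' \<in> words I (Suc n)" "w \<noteq> w'"
      and z: "z \<in> foldr S w ` U \<inter> foldr S w' ` U"
    obtain i v j v' where eq: "w = i # v" "w' = j # v'"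
      using w by (auto simp: length_Suc_conv)
    obtain x y where xy: "x \<in> U" "y \<in> U" "z = S i (foldr S v x)" "z = S j (foldr S v' y)"
      using z eq by auto
    have "foldr S v x \<in> U" "foldr S v' y \<in> U"
      using foldr_image_subset[OF U(1), of v] foldr_image_subset[OF U(1), of v'] w eq xy by auto
    then have "i = j"
      using U(2) xy w eq unfolding disjoint_family_on_def by auto
    then have "foldr S v x = foldr S v' y" using S[of i] xy w eq by (auto dest: injD)
    moreover have "v \<in> words I n" "v' \<in> words I n" "v \<noteq> v'" using w eq \<open>i = j\<close> by auto
    ultimately show False using Suc xy unfolding disjoint_family_on_def by blast
  qed
qed

lemma fixed_set_in_words:
  assumes "F \<subseteq> (\<Union>i\<in>I. S i ` F)" "x \<in> F"
  obtains w where "w \<in> words I n" "x \<in> foldr S w ` F"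
  using assms(2)
proof (induction n arbitrary: x thesis)
  case 0
  then show ?case using 0(1)[of "[]"] by simp
next
  case (Suc n)
  obtain i y where i: "i \<in> I" "y \<in> F" "x = S i y" using assms(1) Suc(3) by blast
  obtain w where "w \<in> words I n" "y \<in> foldr S w ` F" using Suc.IH[OF _ i(2)] by blast
  then show ?case using i by (intro Suc(2)[of "i # w"]) auto
qed

text \<open>
  The open set condition by itself allows the copies of \<open>F\<close> to touch. Precomposing with one fixed
  word \<open>v\<close> that maps \<open>F\<close> into \<open>U\<close> makes them disjoint. This costs the factor \<open>c = r\<^sub>v\<^sup>t\<close> in the sum of
  the ratios, which \<open>(\<Sum>\<^sub>i r\<^sub>i\<^sup>t)\<^sup>n\<close> outgrows.
\<close>

lemma upper_box_dim_ge_SOSC: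
  fixes F U :: "'a::metric_space set" and S :: "'i \<Rightarrow> 'a \<Rightarrow> 'a"
  assumes X: "compact (UNIV :: 'a set)" and I: "finite I"
    and S: "\<And>i. i \<in> I \<Longrightarrow> similarity (r i) (S i)" and r: "\<And>i. i \<in> I \<Longrightarrow> r i < 1"
    and F: "compact F" "F = (\<Union>i\<in>I. S i ` F)"
    and U: "open U" "F \<inter> U \<noteq> {}" "(\<Union>i\<in>I. S i ` U) \<subseteq> U" "disjoint_family_on (\<lambda>i. S i ` U) I"
    and t: "0 \<le> t" "1 < (\<Sum>i\<in>I. r i powr t)"
  shows "ereal t \<le> upper_box_dim F"
proof -
  have pos: "0 < r i" if "i \<in> I" for i using S[OF that] unfolding similarity_def by simp
  obtain q where q: "0 < q" "q < 1" "\<And>i. i \<in> I \<Longrightarrow> r i \<le> q"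
    using uniform_ratio_bound[of I r] I r by metis
  have rq: "0 < r i \<and> r i \<le> q" if "i \<in> I" for i using pos q(3) that by blast
  have ratio: "0 < prod_list (map r w)" "prod_list (map r w) \<le> q ^ length w"
    if "set w \<subseteq> I" for w
    by (rule prod_list_le_power[OF rq that]; assumption)+
  have SF: "(\<Union>i\<in>I. S i ` F) \<subseteq> F" by (rule equalityD2[OF F(2)])
  have sub: "foldr S w ` F \<subseteq> F" if "set w \<subseteq> I" for w
    by (rule foldr_image_subset[OF SF that])
  obtain x \<epsilon> where x: "x \<in> F" "0 < \<epsilon>" "ball x \<epsilon> \<subseteq> U"
    using U(1,2) openE by (metis disjoint_iff)
  (* The summand 1 keeps D positive when F is a single point. *)
  define D where "D = diameter F + 1"
  have D: "0 < D" "\<And>y z. y \<in> F \<Longrightarrow> z \<in> F \<Longrightarrow> dist y z < D"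
    unfolding D_def using diameter_ge_0[OF compact_imp_bounded[OF F(1)]]
      diameter_bounded_bound[OF compact_imp_bounded[OF F(1)]] by force+
  obtain k where k: "q ^ k < \<epsilon> / D"
    using real_arch_pow_inv[of "\<epsilon> / D" q] x(2) D(1) q by auto
  obtain v where v: "v \<in> words I k" "x \<in> foldr S v ` F"
    using fixed_set_in_words[OF equalityD1[OF F(2)] x(1)] .
  have vI: "set v \<subseteq> I" using v by simp
  have vU: "foldr S v ` F \<subseteq> U"
  proof
    fix y assume "y \<in> foldr S v ` F"
    then obtain a b where ab: "a \<in> F" "b \<in> F" "x = foldr S v a" "y = foldr S v b" using v by auto
    have "dist x y = prod_list (map r v) * dist a b"
      using similarity_word[OF S vI] ab unfolding similarity_def by simp
    also have "\<dots> \<le> q ^ k * D"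
      using ratio[OF vI] v D(2)[of a b] ab by (intro mult_mono) auto
    also have "\<dots> < \<epsilon>" using k D(1) by (simp add: field_simps)
    finally show "y \<in> U" using x(3) by auto
  qed
  define c where "c = prod_list (map r v) powr t"
  have c: "0 < c" unfolding c_def using ratio(1)[OF vI] by simp
  obtain n where n: "1 / c < (\<Sum>i\<in>I. r i powr t) ^ n"
    using real_arch_pow[OF t(2)] by blast
  have "(\<Sum>i\<in>I. r i powr t) ^ n \<le> (\<Sum>i\<in>I. r i powr t) ^ Suc n"
    using t(2) by (intro power_increasing) auto
  then have "1 / c \<le> (\<Sum>i\<in>I. r i powr t) ^ Suc n" using n by linarith
  then have n': "1 \<le> (\<Sum>i\<in>I. r i powr t) ^ Suc n * c"
    using c by (simp only: pos_divide_le_eq)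
  (* Length Suc n rather than n: a nonempty w makes the ratio of S_w S_v smaller than 1 even if v is
     empty. *)
  let ?W = "words I (Suc n)"
  let ?T = "\<lambda>w y. foldr S w (foldr S v y)"
  let ?\<rho> = "\<lambda>w. prod_list (map r w) * prod_list (map r v)"
  show ?thesis
  proof (rule upper_box_dim_ge_disjoint_copies[where I = ?W and T = ?T and \<rho> = ?\<rho>, OF X])
    show "finite ?W" using I by (rule finite_lists_length_eq)
    show "similarity (?\<rho> w) (?T w)" if "w \<in> ?W" for w
      using that vI by (intro similarity_compose similarity_word[OF S]) auto
    show "?\<rho> w < 1" if "w \<in> ?W" for w
    proof -
      have wI: "set w \<subseteq> I" using that by simp
      have "prod_list (map r w) \<le> q ^ Suc n" using ratio(2)[OF wI] that by simp
      also have "\<dots> < 1" using q by (intro power_Suc_less_one) auto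
      finally have "prod_list (map r w) < 1" .
      moreover have "prod_list (map r v) \<le> 1"
        using ratio(2)[OF vI] q power_le_one[of q "length v"] by linarith
      ultimately show ?thesis using ratio(1)[OF wI] ratio(1)[OF vI]
        by (meson less_imp_le mult_left_le order_le_less_trans)
    qed
    show "compact F" "F \<noteq> {}" "0 \<le> t" using F x t by auto
    show "(\<Union>w\<in>?W. ?T w ` F) \<subseteq> F"
    proof (rule UN_least)
      fix w assume "w \<in> ?W"
      then have "foldr S w ` F \<subseteq> F" using sub by blast
      then show "?T w ` F \<subseteq> F" using sub[OF vI] unfolding image_subset_iff by blast
    qed
    have "inj (S i)" if "i \<in> I" for i
      by (rule injI) (rule similarity_inj[OF S[OF that]])
    then have "disjoint_family_on (\<lambda>w. foldr S w ` U) ?W"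
      using U(3,4) by (rule disjoint_family_words)
    moreover have "?T w ` F \<subseteq> foldr S w ` U" for w using vU by auto
    ultimately show "disjoint_family_on (\<lambda>w. ?T w ` F) ?W"
      unfolding disjoint_family_on_def by (meson disjoint_iff subsetD)
    have "?\<rho> w powr t = prod_list (map r w) powr t * c" if "w \<in> ?W" for w
      unfolding c_def using that ratio(1)[of w] ratio(1)[OF vI] by (simp add: powr_mult)
    then have "(\<Sum>w\<in>?W. ?\<rho> w powr t) = (\<Sum>w\<in>?W. prod_list (map r w) powr t) * c"
      unfolding sum_distrib_right by (intro sum.cong refl)
    then show "1 \<le> (\<Sum>w\<in>?W. ?\<rho> w powr t)"
      using n' sum_words_powr[OF I pos, where n = "Suc n" and t = t] by simp
  qed
qed

section \<open>The dimension formula\<close>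

lemma is_attractor_attractor:
  fixes C :: "'a::metric_space set"
  assumes "compact (UNIV :: 'a set)" "similarity_ifs S N" "compact C"
  shows "is_attractor S N C (attractor S N C)"
  unfolding attractor_def by (rule theI') (rule is_attractor_ex1[OF assms(2,1,3)])

text \<open>
  Adjoining \<open>F'\<close> to \<open>F\<close> preserves the equation \<open>F = \<Union>\<^sub>i S\<^sub>i(F) \<union> C\<close>, so uniqueness of the attractor
  forces \<open>F'\<close> to be contained in \<open>F\<close> already.
\<close>

lemma homogeneous_subset_inhomogeneous:
  fixes F :: "'a::metric_space set"
  assumes "compact (UNIV :: 'a set)" "similarity_ifs S N"
    and "is_attractor S N C F" "is_attractor S N {} F'"
  shows "F' \<subseteq> F"
proof -
  have "F = (\<Union>i\<in>{1..N}. S i ` F) \<union> C" "F' = (\<Union>i\<in>{1..N}. S i ` F')"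
    using assms(3,4) unfolding is_attractor_def by auto
  then have "F \<union> F' = (\<Union>i\<in>{1..N}. S i ` (F \<union> F')) \<union> C"
    unfolding image_Un UN_Un_distrib by (metis Un_assoc Un_commute)
  then have "is_attractor S N C (F \<union> F')"
    using assms(3,4) unfolding is_attractor_def by (simp add: compact_Un)
  then show ?thesis using is_attractor_subset[OF assms(2,1) _ assms(3)] by blast
qed

theorem corollary2p2:
  fixes S :: "nat \<Rightarrow> 'a::metric_space \<Rightarrow> 'a" and N :: nat and C :: "'a set"
  assumes "compact (UNIV :: 'a set)"
    and "similarity_ifs S N"
    and "C \<noteq> {}" and "compact C"
    and "SOSC S N"
  shows "upper_box_dim (attractor S N C) =
           max (upper_box_dim (attractor S N {})) (upper_box_dim C)"
proof (rule antisym)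
  note X = assms(1)
  define F where "F = attractor S N {}"
  define G where "G = attractor S N C"
  have F: "is_attractor S N {} F" and G: "is_attractor S N C G"
    unfolding F_def G_def using is_attractor_attractor[OF assms(1,2)] assms(4) by auto
  have neF: "F \<noteq> {}" using F unfolding is_attractor_def by blast
  obtain r where r: "\<And>i. i \<in> {1..N} \<Longrightarrow> 0 < r i \<and> r i < 1 \<and>
      (\<forall>x y. dist (S i x) (S i y) = r i * dist x y)"
    using assms(2) unfolding similarity_ifs_def by metis
  have sim: "similarity (r i) (S i)" "r i < 1" if "i \<in> {1..N}" for i
    using r[OF that] unfolding similarity_def by auto
  have ne: "{1..N} \<noteq> {}" using assms(2) by (auto simp: similarity_ifs_def)
  have "F \<subseteq> G" by (rule homogeneous_subset_inhomogeneous[OF assms(1,2) G F])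
  moreover have "C \<subseteq> G" using G unfolding is_attractor_def by blast
  ultimately show "max (upper_box_dim F) (upper_box_dim C) \<le> upper_box_dim G"
    using upper_box_dim_mono[OF X] neF assms(3) by simp
  show "upper_box_dim G \<le> max (upper_box_dim F) (upper_box_dim C)"
  proof (rule ccontr)
    assume "\<not> ?thesis"
    then obtain t' where t': "max (upper_box_dim F) (upper_box_dim C) < ereal t'"
        "ereal t' < upper_box_dim G"
      using ereal_dense2 by (metis not_le)
    (* The lower bound for F only gives a sum of at most 1 at t'; the strict inequality needed for
       the upper bound comes from passing to a larger exponent t. *)
    then obtain t where t: "ereal t' < ereal t" "ereal t < upper_box_dim G"
      using ereal_dense2 by blast
    have "0 \<le> upper_box_dim F" by (rule upper_box_dim_nonneg[OF X neF])
    also have "\<dots> < ereal t'" using t'(1) by simp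
    finally have nonneg: "0 \<le> t'" "0 \<le> t" "t' < t" using t(1) by auto
    have "(\<Sum>i\<in>{1..N}. r i powr t) < 1"
    proof -
      have "(\<Sum>i\<in>{1..N}. r i powr t) < (\<Sum>i\<in>{1..N}. r i powr t')"
        using ne r nonneg(3) by (intro sum_strict_mono powr_less_mono') auto
      moreover have "(\<Sum>i\<in>{1..N}. r i powr t') \<le> 1"
      proof (rule ccontr)
        assume "\<not> ?thesis"
        moreover obtain U where "open U" "F \<inter> U \<noteq> {}" "(\<Union>i\<in>{1..N}. S i ` U) \<subseteq> U"
            "disjoint_family_on (\<lambda>i. S i ` U) {1..N}"
          using assms(5) unfolding SOSC_def F_def by blast
        moreover have "compact F" "F = (\<Union>i\<in>{1..N}. S i ` F)"
          using F unfolding is_attractor_def by auto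
        ultimately have "ereal t' \<le> upper_box_dim F"
          using nonneg(1) sim by (intro upper_box_dim_ge_SOSC[OF X, of "{1..N}" r S]) auto
        then show False using t'(1) by (simp add: not_less[symmetric])
      qed
      ultimately show ?thesis by linarith
    qed
    moreover have "upper_box_dim C < ereal t" using t' t by (meson max_less_iff_conj less_trans)
    moreover have "G \<subseteq> (\<Union>i\<in>{1..N}. S i ` G) \<union> C" "G \<noteq> {}"
      using G unfolding is_attractor_def by auto
    ultimately have "upper_box_dim G \<le> ereal t"
      using sim assms(3) nonneg(2)
      by (intro upper_box_dim_inhomogeneous_le[OF X, of "{1..N}" r S]) auto
    then show False using t(2) by simp
  qed
qed

end
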